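(* Let $Q=T[H_1,\dots,H_t]$ be a strong semicomplete composition, where $H_i$ has $n_i$ vertices. Then $Q$ has a Hamiltonian cycle if and only if the extended semicomplete digraph $Q'=T[\overline{K}_{n_1},\dots,\overline{K}_{n_t}]$ has a cycle subdigraph which covers at least $pc(H_i)$ vertices of $\overline{K}_{n_i}$ for every $i\in\{1,\dots,t\}$.
   Context: Digraphs are finite, without loops or parallel arcs (2-cycles are allowed); paths and cycles are directed, a single vertex is a path, and cycles have length at least 2. A digraph is semicomplete if there is at least one arc between every pair of distinct vertices. Let $T$ be a digraph with vertices $u_1,\dots,u_t$ ($t\ge 2$) and let $H_1,\dots,H_t$ be pairwise disjoint nonempty digraphs. The composition $Q=T[H_1,\dots,H_t]$ is the digraph with vertex set $\bigcup_i V(H_i)$ and arc set $\bigcup_{i=1}^t A(H_i)\cup\{xy : x\in V(H_i),\ y\in V(H_p),\ u_iu_p\in A(T)\}$. It is a semicomplete composition if $T$ is semicomplete. $\overline{K}_p$ denotes the digraph of order $p$ with no arcs. A digraph is strong if for every ordered pair of vertices $(x,y)$ there is a directed path from $x$ to $y$. A cycle subdigraph of $D$ is a collection of pairwise vertex-disjoint cycles of $D$. The path covering number $pc(D)$ is the smallest $k$ such that $V(D)$ can be covered by $k$ pairwise vertex-disjoint paths of $D$. A Hamiltonian cycle is a cycle containing all vertices. *)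

theory Defs
  imports
    "Graph_Theory.Graph_Theory"
    "HOL-Library.Disjoint_Sets"
begin

text \<open>
  Finite digraphs without loops or parallel arcs are instances of \<^locale>\<open>pair_digraph\<close>:
  arcs are ordered pairs of vertices, so parallel arcs cannot occur while 2-cycles can.
\<close>

definition semicomplete :: "'a pair_pre_digraph \<Rightarrow> bool" where
  "semicomplete G \<longleftrightarrow> pair_digraph G \<and>
     (\<forall>u\<in>pverts G. \<forall>v\<in>pverts G. u \<noteq> v \<longrightarrow> (u, v) \<in> parcs G \<or> (v, u) \<in> parcs G)"

text \<open>
  The digraphs substituted for the vertices of \<open>T\<close> are indexed by these vertices themselves:
  \<open>H u\<^sub>i\<close> plays the role of $H_i$.
\<close>

definition composition ::
    "'a pair_pre_digraph \<Rightarrow> ('a \<Rightarrow> 'b pair_pre_digraph) \<Rightarrow> 'b pair_pre_digraph" where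
  "composition T H = \<lparr>
     pverts = (\<Union>u\<in>pverts T. pverts (H u)),
     parcs = (\<Union>u\<in>pverts T. parcs (H u)) \<union>
       {(x, y). \<exists>u\<in>pverts T. \<exists>v\<in>pverts T.
          x \<in> pverts (H u) \<and> y \<in> pverts (H v) \<and> (u, v) \<in> parcs T} \<rparr>"

definition composition_data ::
    "'a pair_pre_digraph \<Rightarrow> ('a \<Rightarrow> 'b pair_pre_digraph) \<Rightarrow> bool" where
  "composition_data T H \<longleftrightarrow>
     pair_digraph T \<and> 2 \<le> card (pverts T) \<and>
     (\<forall>u\<in>pverts T. pair_digraph (H u) \<and> pverts (H u) \<noteq> {}) \<and>
     disjoint_family_on (\<lambda>u. pverts (H u)) (pverts T)"

definition is_edgeless :: "nat \<Rightarrow> 'a pair_pre_digraph \<Rightarrow> bool" where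
  "is_edgeless p G \<longleftrightarrow> pair_digraph G \<and> card (pverts G) = p \<and> parcs G = {}"

text \<open>
  Cycles are lists of arcs. The bound on the length is redundant in loopfree digraphs; it is
  needed in general because \<^const>\<open>pre_digraph.cycle\<close> admits loops.
\<close>

definition dicycle :: "'a pair_pre_digraph \<Rightarrow> ('a \<times> 'a) list \<Rightarrow> bool" where
  "dicycle G c \<longleftrightarrow> pre_digraph.cycle (with_proj G) c \<and> 2 \<le> length c"

definition cycle_verts :: "('a \<times> 'a) list \<Rightarrow> 'a set" where
  "cycle_verts c = fst ` set c"

definition hamiltonian_cycle :: "'a pair_pre_digraph \<Rightarrow> ('a \<times> 'a) list \<Rightarrow> bool" where
  "hamiltonian_cycle G c \<longleftrightarrow> dicycle G c \<and> cycle_verts c = pverts G"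

definition cycle_subdigraph :: "'a pair_pre_digraph \<Rightarrow> ('a \<times> 'a) list set \<Rightarrow> bool" where
  "cycle_subdigraph G C \<longleftrightarrow> (\<forall>c\<in>C. dicycle G c) \<and> disjoint_family_on cycle_verts C"

text \<open>Paths are nonempty lists of distinct vertices (\<^const>\<open>vpath\<close>).\<close>

definition path_cover :: "'a pair_pre_digraph \<Rightarrow> 'a list set \<Rightarrow> bool" where
  "path_cover G P \<longleftrightarrow> finite P \<and> (\<forall>p\<in>P. vpath p (with_proj G)) \<and>
     disjoint_family_on set P \<and> (\<Union>p\<in>P. set p) = pverts G"

definition path_covering_number :: "'a pair_pre_digraph \<Rightarrow> nat" where
  "path_covering_number G = (LEAST k. \<exists>P. path_cover G P \<and> card P = k)"

end

theory Submission
  imports Defs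
begin

text \<open>
  Cutting a Hamiltonian cycle of $Q$ at the arcs that come from $T$ leaves, for every $i$, a path
  cover of $H_i$; contracting each path to a vertex gives a single cycle of $Q'$.

  Conversely, every part of $Q'$ is met by the given cycles, so they form a cycle factor of a strong
  extended semicomplete digraph; it suffices to merge them into one cycle, because the vertices
  of that cycle in $\overline{K}_{n_i}$ can then be replaced by the paths of a path cover of $H_i$
  of exactly the right size. Two cycles $X, Y$ meeting a common part are merged by exchanging the
  successors of two vertices of that part. If no exchange of the successors of $x \in X$ and
  $y \in Y$ is possible, then a vertex of $X$ without in-neighbours in $Y$ passes this property on
  to its successor, and one without out-neighbours passes it on to its predecessor. Hence either all
  arcs between $X$ and $Y$ have the same direction, or every vertex of $X$ can be inserted
  into $Y$, and so can the whole of $X$. If no two cycles can be merged, the cycles form a strong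
  tournament under domination, which contains a triangle, and the three cycles of a triangle can be
  concatenated.
\<close>

section \<open>Cyclic reading of lists\<close>

text \<open>A list is read cyclically: \<open>vs = []\<close> gives the arc from the last element to the first.\<close>

definition cyc_arc :: "'a list \<Rightarrow> 'a \<Rightarrow> 'a \<Rightarrow> bool" where
  "cyc_arc l x y \<longleftrightarrow> (\<exists>us vs. l = us @ vs \<and> us \<noteq> [] \<and> last us = x \<and> hd (vs @ us) = y)"

definition list_cycle :: "('a \<Rightarrow> 'a \<Rightarrow> bool) \<Rightarrow> 'a list \<Rightarrow> bool" where
  "list_cycle R l \<longleftrightarrow> l \<noteq> [] \<and> distinct l \<and> successively R l \<and> R (last l) (hd l)"

lemma cyc_arcI:
  "l = us @ vs \<Longrightarrow> us \<noteq> [] \<Longrightarrow> last us = x \<Longrightarrow> hd (vs @ us) = y \<Longrightarrow> cyc_arc l x y"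
  by (auto simp: cyc_arc_def)

lemma cyc_arc_nth:
  assumes "Suc i < length l" shows "cyc_arc l (l ! i) (l ! Suc i)"
proof (rule cyc_arcI)
  show "l = take (Suc i) l @ drop (Suc i) l" by simp
  show "last (take (Suc i) l) = l ! i" using assms by (simp add: take_Suc_conv_app_nth)
  show "hd (drop (Suc i) l @ take (Suc i) l) = l ! Suc i"
    using assms by (simp add: hd_append hd_drop_conv_nth)
qed (use assms in auto)

lemma cyc_arc_in_set: "cyc_arc l x y \<Longrightarrow> x \<in> set l \<and> y \<in> set l"
  by (auto simp: cyc_arc_def hd_append)

lemma cyc_arc_last_hd: "l \<noteq> [] \<Longrightarrow> cyc_arc l (last l) (hd l)"
  by (rule cyc_arcI[of _ l "[]"]) auto

lemma cyc_arc_successor: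
  assumes "x \<in> set l" shows "\<exists>y. cyc_arc l x y"
proof -
  from assms obtain us vs where "l = us @ x # vs" by (meson split_list)
  then have "cyc_arc l x (hd (vs @ us @ [x]))" by (intro cyc_arcI[of _ "us @ [x]" vs]) auto
  then show ?thesis ..
qed

lemma cyc_arc_predecessor:
  assumes "y \<in> set l" shows "\<exists>x. cyc_arc l x y"
proof -
  from assms obtain us vs where l: "l = us @ y # vs" by (meson split_list)
  show ?thesis
  proof (cases "us = []")
    case True
    with l cyc_arc_last_hd[of l] show ?thesis by auto
  next
    case False
    with l have "cyc_arc l (last us) y" by (intro cyc_arcI[of _ us "y # vs"]) auto
    then show ?thesis ..
  qed
qed

lemma cyc_arc_rotate:
  assumes "cyc_arc (us @ vs) x y" shows "cyc_arc (vs @ us) x y"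
proof -
  from assms obtain ps qs where pq: "us @ vs = ps @ qs" "ps \<noteq> []" "last ps = x" "hd (qs @ ps) = y"
    by (auto simp: cyc_arc_def)
  from pq(1) consider r where "us = ps @ r" "qs = r @ vs" | r where "ps = us @ r" "vs = r @ qs"
    by (auto simp: append_eq_append_conv2)
  then show ?thesis
  proof cases
    case 1
    with pq show ?thesis
        by (intro cyc_arcI[of _ "vs @ ps" r]) (auto simp: hd_append)
  next
    case 2
    \<comment> \<open>If \<open>r\<close> is empty, \<open>x\<close> ends \<open>us\<close>, so
      after the rotation its arc is the closing one.\<close>
    show ?thesis
    proof (cases "r = []")
      case True
      with 2 pq show ?thesis
        by (intro cyc_arcI[of _ "vs @ us" "[]"]) (auto simp: hd_append)
    next
      case False
      with 2 pq show ?thesis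
        by (intro cyc_arcI[of _ r "qs @ us"]) (auto simp: hd_append)
    qed
  qed
qed

text \<open>Appending can destroy only the closing arc. Insertion places at all other arcs therefore
  survive when a segment is put at the end.\<close>

lemma cyc_arc_append:
  assumes "cyc_arc l x y" and "(x, y) \<noteq> (last l, hd l)"
  shows "cyc_arc (l @ p) x y"
proof -
  from assms(1) obtain us vs where l: "l = us @ vs" "us \<noteq> []" "last us = x" "hd (vs @ us) = y"
    by (auto simp: cyc_arc_def)
  with assms(2) have "vs \<noteq> []" by auto
  with l show ?thesis by (intro cyc_arcI[of _ us "vs @ p"]) auto
qed

text \<open>Puts the closing arc on the same footing as the others, which makes invariance under
  rotation and monotonicity in \<open>R\<close> immediate.\<close>

lemma list_cycle_iff:
  "list_cycle R l \<longleftrightarrow> l \<noteq> [] \<and> distinct l \<and> (\<forall>x y. cyc_arc l x y \<longrightarrow> R x y)"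
proof (intro iffI conjI allI impI)
  fix x y
  assume c: "list_cycle R l" and "cyc_arc l x y"
  then obtain us vs where l: "l = us @ vs" "us \<noteq> []" "last us = x" "hd (vs @ us) = y"
    by (auto simp: cyc_arc_def)
  with c show "R x y"
    by (cases "vs = []") (auto simp: list_cycle_def successively_append_iff)
next
  assume r: "l \<noteq> [] \<and> distinct l \<and> (\<forall>x y. cyc_arc l x y \<longrightarrow> R x y)"
  have "successively R l"
    unfolding successively_conv_nth
  proof (intro allI impI)
    fix i assume i: "Suc i < length l"
    from cyc_arc_nth[OF i] r show "R (l ! i) (l ! Suc i)" by blast
  qed
  with r show "list_cycle R l" by (auto simp: list_cycle_def cyc_arc_last_hd)
qed (auto simp: list_cycle_def)

lemma list_cycle_rotate: "list_cycle R (us @ vs) \<Longrightarrow> list_cycle R (vs @ us)"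
  unfolding list_cycle_iff by (auto dest: cyc_arc_rotate)

text \<open>Makes a chosen arc the closing one, so that cutting the cycle at this arc means reading
  the list as a path.\<close>

lemma list_cycle_rotate_to_arc:
  assumes "list_cycle R l" and "cyc_arc l x y"
  obtains l' where "list_cycle R l'" "set l' = set l" "hd l' = y" "last l' = x"
    "\<And>u v. cyc_arc l u v \<Longrightarrow> cyc_arc l' u v"
proof -
  from assms(2) obtain us vs where l: "l = us @ vs" "us \<noteq> []" "last us = x" "hd (vs @ us) = y"
    by (auto simp: cyc_arc_def)
  show ?thesis
  proof (rule that[of "vs @ us"])
    show "list_cycle R (vs @ us)" using assms(1) l(1) by (auto intro: list_cycle_rotate)
  qed (use l cyc_arc_rotate in auto)
qed

text \<open>Propagation around a cycle: once \<open>z\<close> is rotated to the front, every vertex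
  is reached by going along the list, without the closing arc.\<close>

lemma cyc_arc_closed_set:
  assumes "z \<in> set l" "z \<in> S"
    and closed: "\<And>x y. cyc_arc l x y \<Longrightarrow> x \<in> S \<Longrightarrow> y \<in> S"
  shows "set l \<subseteq> S"
proof -
  have suc: "set k \<subseteq> S"
    if "successively (\<lambda>x y. x \<in> S \<longrightarrow> y \<in> S) k" "k \<noteq> []" "hd k \<in> S" for k
    using that
  proof (induction k)
    case (Cons a k)
    then show ?case by (cases "k = []") (simp_all add: successively_Cons)
  qed simp
  from assms(1) obtain us vs where l: "l = us @ z # vs" by (meson split_list)
  have "cyc_arc l x y" if "cyc_arc ((z # vs) @ us) x y" for x y
    using cyc_arc_rotate[OF that] l by simp
  then have arcs: "\<forall>x y. cyc_arc ((z # vs) @ us) x y \<longrightarrow> x \<in> S \<longrightarrow> y \<in> S" 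
    using closed by blast
  have "successively (\<lambda>x y. x \<in> S \<longrightarrow> y \<in> S) ((z # vs) @ us)"
    unfolding successively_conv_nth
  proof (intro allI impI)
    let ?l = "(z # vs) @ us"
    fix i assume i: "Suc i < length ?l" "?l ! i \<in> S"
    from cyc_arc_nth[OF i(1)] arcs i show "?l ! Suc i \<in> S" by blast
  qed
  from suc[OF this] assms(2) l show ?thesis by auto
qed

section \<open>Inserting into and merging cycles\<close>

text \<open>
  The initial segment of \<open>p\<close> up to the last vertex insertable between \<open>y\<close> and \<open>y'\<close> is inserted
  there as a whole, so the remaining vertices do not need the destroyed arc \<open>(y, y')\<close>.
\<close>

lemma list_cycle_multi_insertion:
  assumes "list_cycle R l" "successively R p" "distinct p" "set l \<inter> set p = {}"
    and "\<And>x. x \<in> set p \<Longrightarrow> \<exists>y y'. cyc_arc l y y' \<and> R y x \<and> R x y'"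
  shows "\<exists>c. list_cycle R c \<and> set c = set l \<union> set p"
  using assms
proof (induction "length p" arbitrary: l p rule: less_induct)
  case less
  show ?case
  proof (cases p)
    case Nil
    with less.prems show ?thesis by auto
  next
    case (Cons a as)
    with less.prems(5)[of a] obtain y y' where a: "cyc_arc l y y'" "R y a" "R a y'" by auto
    from list_cycle_rotate_to_arc[OF less.prems(1) a(1)] obtain k where
      k: "list_cycle R k" "set k = set l" "hd k = y'" "last k = y"
        "\<And>u v. cyc_arc l u v \<Longrightarrow> cyc_arc k u v" by blast
    have "\<exists>x\<in>set p. R y x \<and> R x y'" using a Cons by auto
    then obtain q b r where p: "p = q @ b # r" "R y b" "R b y'"
        and r: "\<forall>x\<in>set r. \<not> (R y x \<and> R x y')"
      using split_list_last_prop[of p "\<lambda>x. R y x \<and> R x y'"] by blast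
    let ?l = "k @ q @ [b]"
    \<comment> \<open>The inserted segment starts with \<open>a\<close>, so it is entered by the arc
      from \<open>y\<close> to \<open>a\<close> and left by the arc from \<open>b\<close> to
      \<open>y'\<close>.\<close>
    have hd: "hd (q @ [b]) = a" using p Cons by (cases q) auto
    have s: "successively R (q @ [b])" "successively R r"
      using less.prems(2) p by (auto simp: successively_append_iff successively_Cons)
    have c: "list_cycle R ?l"
      using k a(2) p less.prems(3,4) s hd
      by (auto simp: list_cycle_def successively_append_iff)
    have "\<exists>c. list_cycle R c \<and> set c = set ?l \<union> set r"
    proof (rule less.hyps)
      show "length r < length p" using p by simp
      show "list_cycle R ?l" by fact
      show "successively R r" by fact
      show "distinct r" "set ?l \<inter> set r = {}"
        using less.prems(3,4) p k(2) by auto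
      fix x assume x: "x \<in> set r"
      then obtain u v where uv: "cyc_arc l u v" "R u x" "R x v"
        using less.prems(5)[of x] p by auto
      with r x have "(u, v) \<noteq> (last k, hd k)" using k by auto
      from cyc_arc_append[OF k(5)[OF uv(1)] this] uv
      show "\<exists>y y'. cyc_arc ?l y y' \<and> R y x \<and> R x y'" by blast
    qed
    then show ?thesis using k(2) p by auto
  qed
qed

text \<open>Cut at the given arcs, the cycles become paths from \<open>x'\<close> to
  \<open>x\<close> and from \<open>y'\<close> to \<open>y\<close>; the two arcs assumed in
  \<open>R\<close> join their ends crosswise.\<close>

lemma list_cycle_append_swap:
  assumes "list_cycle R p" "list_cycle R q" "set p \<inter> set q = {}"
    and "cyc_arc p x x'" "cyc_arc q y y'" "R x y'" "R y x'"
  shows "\<exists>c. list_cycle R c \<and> set c = set p \<union> set q"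
proof -
  obtain p' where p': "list_cycle R p'" "set p' = set p" "hd p' = x'" "last p' = x"
    using list_cycle_rotate_to_arc[OF assms(1,4)] by blast
  obtain q' where q': "list_cycle R q'" "set q' = set q" "hd q' = y'" "last q' = y"
    using list_cycle_rotate_to_arc[OF assms(2,5)] by blast
  have "list_cycle R (p' @ q')"
    using p' q' assms(3,6,7) by (auto simp: list_cycle_def successively_append_iff)
  with p' q' show ?thesis by (intro exI[of _ "p' @ q'"]) auto
qed

text \<open>The absence of backward arcs is part of the notion: it makes domination asymmetric on
  nonempty lists, and a single arc entering a dominating cycle from a dominated one refutes
  it.\<close>

definition cycle_dominates :: "('a \<Rightarrow> 'a \<Rightarrow> bool) \<Rightarrow> 'a list \<Rightarrow> 'a list \<Rightarrow> bool" where
  "cycle_dominates R p q \<longleftrightarrow> (\<forall>x\<in>set p. \<forall>y\<in>set q. R x y \<and> \<not> R y x)"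

lemma list_cycle_merge_or_dominates:
  assumes p: "list_cycle R p" and q: "list_cycle R q" and disj: "set p \<inter> set q = {}"
    and adj: "\<And>x y. x \<in> set p \<Longrightarrow> y \<in> set q \<Longrightarrow> R x y \<or> R y x"
    and no_merge: "\<nexists>c. list_cycle R c \<and> set c = set p \<union> set q"
  shows "cycle_dominates R p q \<or> cycle_dominates R q p"
proof -
  have no_swap: "\<not> (R x y' \<and> R y x')" if "cyc_arc p x x'" "cyc_arc q y y'" for x x' y y'
    using list_cycle_append_swap[OF p q disj that] no_merge by blast
  \<comment> \<open>Otherwise every vertex of \<open>p\<close> has in- and out-neighbours in
    \<open>q\<close>, and each can be inserted into \<open>q\<close>.\<close>
  have "\<exists>x\<in>set p. (\<forall>y\<in>set q. \<not> R y x) \<or> (\<forall>y\<in>set q. \<not> R x y)"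
  proof (rule ccontr)
    assume neg: "\<not> ?thesis"
    have "\<exists>y y'. cyc_arc q y y' \<and> R y x \<and> R x y'" if x: "x \<in> set p" for x
    proof (rule ccontr)
      assume no: "\<not> ?thesis"
      from neg x obtain z w where z: "z \<in> set q" "R z x" and w: "w \<in> set q" "R x w" by blast
      \<comment> \<open>If \<open>x\<close> fits nowhere, the successor of an in-neighbour is no
        out-neighbour, hence again an in-neighbour. So all of \<open>q\<close> consists of
        in-neighbours, and \<open>x\<close> fits just before \<open>w\<close> after all.\<close>
      have "set q \<subseteq> {y. R y x}"
      proof (rule cyc_arc_closed_set[OF z(1)])
        fix y y' assume "cyc_arc q y y'" "y \<in> {y. R y x}"
        with no adj[OF x, of y'] cyc_arc_in_set[of q y y'] show "y' \<in> {y. R y x}" by auto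
      qed (use z in simp)
      moreover obtain v where "cyc_arc q v w" using cyc_arc_predecessor[OF w(1)] by blast
      ultimately show False using no w cyc_arc_in_set[of q v w] by auto
    qed
    from list_cycle_multi_insertion[OF q, of p] this p disj no_merge
    show False by (auto simp: list_cycle_def Int_commute Un_commute)
  qed
  then obtain x where x: "x \<in> set p"
    and "(\<forall>y\<in>set q. \<not> R y x) \<or> (\<forall>y\<in>set q. \<not> R x y)" by blast
  then consider "\<forall>y\<in>set q. \<not> R y x" | "\<forall>y\<in>set q. \<not> R x y" by blast
  then show ?thesis
  proof cases
    case 1
    have "set p \<subseteq> {x. \<forall>y\<in>set q. \<not> R y x}"
    proof (rule cyc_arc_closed_set[OF x])
      fix u u' assume u: "cyc_arc p u u'" "u \<in> {x. \<forall>y\<in>set q. \<not> R y x}"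
      \<comment> \<open>Since \<open>u\<close> has no in-neighbour in \<open>q\<close>, it has an
        arc to the successor \<open>y'\<close> of \<open>y\<close>; an arc from \<open>y\<close> to
        \<open>u'\<close> would complete an exchange.\<close>
      have "\<not> R y u'" if y: "y \<in> set q" for y
      proof -
        obtain y' where y': "cyc_arc q y y'" using cyc_arc_successor[OF y] by blast
        then have "R u y'" using u adj cyc_arc_in_set by fastforce
        with no_swap[OF u(1) y'] show ?thesis by blast
      qed
      then show "u' \<in> {x. \<forall>y\<in>set q. \<not> R y x}" by blast
    qed (use 1 in simp)
    then show ?thesis using adj by (fastforce simp: cycle_dominates_def)
  next
    case 2
    have "set p \<subseteq> {x. \<forall>y\<in>set q. \<not> R x y}"
    proof (rule ccontr)
      assume "\<not> ?thesis"
      then obtain z where z: "z \<in> set p" "z \<in> {x. \<exists>y\<in>set q. R x y}" by blast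
      \<comment> \<open>Lacking out-neighbours is inherited by predecessors, so the complementary
        property is propagated along successors until it reaches \<open>x\<close>.\<close>
      have "set p \<subseteq> {x. \<exists>y\<in>set q. R x y}"
      proof (rule cyc_arc_closed_set[OF z])
        fix u u' assume u: "cyc_arc p u u'" "u \<in> {x. \<exists>y\<in>set q. R x y}"
        then obtain y' where y': "y' \<in> set q" "R u y'" by blast
        obtain y where y: "cyc_arc q y y'" using cyc_arc_predecessor[OF y'(1)] by blast
        with no_swap[OF u(1) y] y' have "\<not> R y u'" by blast
        then show "u' \<in> {x. \<exists>y\<in>set q. R x y}"
          using adj u y cyc_arc_in_set by fastforce
      qed
      with x 2 show False by blast
    qed
    then show ?thesis using adj by (fastforce simp: cycle_dominates_def)
  qed
qed

section \<open>Merging a cycle factor into a single cycle\<close>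

text \<open>Induction on \<open>F\<close>: if the new element \<open>x\<close> beats the old source
  \<open>m\<close>, it beats every other \<open>p\<close> too, for otherwise \<open>x\<close>,
  \<open>m\<close>, \<open>p\<close> form a triangle. A source is what strong connectivity will
  exclude.\<close>

lemma finite_no_triangle_source:
  assumes "finite F" "F \<noteq> {}"
    and total: "\<And>p q. p \<in> F \<Longrightarrow> q \<in> F \<Longrightarrow> p \<noteq> q \<Longrightarrow> D p q \<or> D q p"
    and no_triangle: "\<And>p q r. p \<in> F \<Longrightarrow> q \<in> F \<Longrightarrow> r \<in> F \<Longrightarrow> D p q \<Longrightarrow> D q r \<Longrightarrow> \<not> D r p"
  shows "\<exists>m\<in>F. \<forall>p\<in>F. p \<noteq> m \<longrightarrow> D m p"
  using assms
proof (induction F rule: finite_ne_induct)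
  case (singleton x)
  show ?case by simp
next
  case (insert x F)
  have "\<exists>m\<in>F. \<forall>p\<in>F. p \<noteq> m \<longrightarrow> D m p"
    by (rule insert.IH; meson insert.prems insertI2)
  then obtain m where m: "m \<in> F" "\<forall>p\<in>F. p \<noteq> m \<longrightarrow> D m p" by blast
  show ?case
  proof (cases "D m x")
    case True
    with m show ?thesis by (intro bexI[of _ m]) auto
  next
    case False
    with insert.prems(1)[of x m] m insert.hyps have xm: "D x m" by auto
    have "D x p" if "p \<in> F" "p \<noteq> m" for p
      using insert.prems(1)[of x p] insert.prems(2)[of x m p] m xm that insert.hyps by auto
    with xm show ?thesis by (intro bexI[of _ x]) auto
  qed
qed

text \<open>The map \<open>\<tau>\<close> sends a vertex of an extended semicomplete digraph to its part, so that
  adjacency only depends on the images under \<open>\<tau>\<close>.\<close>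

lemma list_cycle_factor_imp_hamiltonian:
  fixes A :: "('a \<times> 'a) set" and \<tau> :: "'v \<Rightarrow> 'a"
  defines "R \<equiv> \<lambda>x y. (\<tau> x, \<tau> y) \<in> A"
  assumes semi: "\<And>a b. a \<in> W \<Longrightarrow> b \<in> W \<Longrightarrow> a \<noteq> b \<Longrightarrow> (a, b) \<in> A \<or> (b, a) \<in> A"
    and cut: "\<And>U. U \<noteq> {} \<Longrightarrow> U \<subset> W \<Longrightarrow> \<exists>a\<in>W - U. \<exists>b\<in>U. (a, b) \<in> A"
    and "finite F" "F \<noteq> {}" "\<And>c. c \<in> F \<Longrightarrow> list_cycle R c" "disjoint_family_on set F"
    and "\<tau> ` (\<Union>c\<in>F. set c) = W"
  shows "\<exists>c. list_cycle R c \<and> set c = (\<Union>c\<in>F. set c)"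
  using assms(4-)
proof (induction "card F" arbitrary: F rule: less_induct)
  case less
  \<comment> \<open>Replacing at least two cycles by one on the same vertices gives a smaller
    factor, to which the induction hypothesis applies.\<close>
  have merged: ?case
    if GF: "G \<subseteq> F" "2 \<le> card G" and c: "list_cycle R c" "set c = (\<Union>d\<in>G. set d)" for G c
  proof -
    let ?F = "insert c (F - G)"
    have fin: "finite G" using GF less.prems(1) finite_subset by blast
    have un: "(\<Union>d\<in>?F. set d) = (\<Union>d\<in>F. set d)" using c GF by auto
    have disj: "set d \<inter> set e = {}" if "d \<in> F" "e \<in> F" "d \<noteq> e" for d e
      using less.prems(4) that unfolding disjoint_family_on_def by blast
    have "\<exists>c. list_cycle R c \<and> set c = (\<Union>d\<in>?F. set d)"
    proof (rule less.hyps)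
      have "card ?F \<le> Suc (card (F - G))"
        by (simp add: less.prems(1) card_insert_if)
      also have "\<dots> < card F"
        using GF fin card_mono[OF less.prems(1) GF(1)] by (simp add: card_Diff_subset)
      finally show "card ?F < card F" .
      show "disjoint_family_on set ?F"
        unfolding disjoint_family_on_def using c disj GF by fastforce
    qed (use less.prems c un in auto)
    with un show ?thesis by simp
  qed
  show ?case
  proof (cases "\<exists>G c. G \<subseteq> F \<and> 2 \<le> card G \<and> list_cycle R c \<and> set c = (\<Union>d\<in>G. set d)")
    case True
    then show ?thesis using merged by blast
  next
    case no: False
    have W: "\<tau> x \<in> W" if "x \<in> set c" "c \<in> F" for x c using that less.prems(5) by blast
    have disj: "set d \<inter> set e = {}" if "d \<in> F" "e \<in> F" "d \<noteq> e" for d e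
      using less.prems(4) that unfolding disjoint_family_on_def by blast
    have no2: "\<nexists>c. list_cycle R c \<and> set c = set d \<union> set e" if "d \<in> F" "e \<in> F" "d \<noteq> e" for d e
    proof
      assume "\<exists>c. list_cycle R c \<and> set c = set d \<union> set e"
      moreover have "card {d, e} = 2" using that by simp
      moreover have "(\<Union>c\<in>{d, e}. set c) = set d \<union> set e" by simp
      ultimately show False using no that by (metis empty_subsetI insert_subset order_refl)
    qed
    \<comment> \<open>Vertices of the same part have the same out-neighbours, so their successors
      could be exchanged. Hence unmergeable cycles share no part, and any two of their vertices are
      adjacent.\<close>
    have type_neq: "\<tau> x \<noteq> \<tau> y"
      if F: "d \<in> F" "e \<in> F" "d \<noteq> e" and xy: "x \<in> set d" "y \<in> set e" for d e x y
    proof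
      assume eq: "\<tau> x = \<tau> y"
      obtain x' y' where a: "cyc_arc d x x'" "cyc_arc e y y'" using cyc_arc_successor xy by metis
      then have "R x x'" "R y y'" using less.prems(3) F by (auto simp: list_cycle_iff)
      then have "R x y'" "R y x'" using eq by (auto simp: R_def)
      from list_cycle_append_swap[OF less.prems(3)[OF F(1)] less.prems(3)[OF F(2)] disj[OF F]
          a this]
      show False using no2 F by blast
    qed
    have dom: "cycle_dominates R d e \<or> cycle_dominates R e d" if "d \<in> F" "e \<in> F" "d \<noteq> e" for d e
    proof (rule list_cycle_merge_or_dominates)
      fix x y assume xy: "x \<in> set d" "y \<in> set e"
      show "R x y \<or> R y x"
        using semi[OF W[OF xy(1) that(1)] W[OF xy(2) that(2)] type_neq[OF that xy]]
        by (simp add: R_def)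
    qed (use that less.prems(3) disj no2 in auto)
    have ne: "d \<noteq> []" if "d \<in> F" for d using less.prems(3)[OF that] by (simp add: list_cycle_def)
    have asym: "\<not> cycle_dominates R e d" if "d \<in> F" "e \<in> F" "cycle_dominates R d e" for d e
      using that ne[OF that(1)] ne[OF that(2)] unfolding cycle_dominates_def by (metis hd_in_set)
    have "\<exists>m\<in>F. \<forall>d\<in>F. d \<noteq> m \<longrightarrow> cycle_dominates R m d"
    proof (rule finite_no_triangle_source[OF less.prems(1,2)])
      fix d e g assume F: "d \<in> F" "e \<in> F" "g \<in> F"
        and D: "cycle_dominates R d e" "cycle_dominates R e g"
      show "\<not> cycle_dominates R g d"
      proof
        assume D': "cycle_dominates R g d"
        have neq: "d \<noteq> e" "e \<noteq> g" "g \<noteq> d" using D D' asym F by blast+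
        have dg: "set d \<inter> set e = {}" "set e \<inter> set g = {}" "set d \<inter> set g = {}"
          using disj F neq by blast+
        \<comment> \<open>Domination supplies arcs between arbitrary vertices, so the three lists
          are concatenated as they stand, without rotation.\<close>
        have "R (last d) (hd e)" "R (last e) (hd g)" "R (last g) (hd d)"
          using D D' ne F unfolding cycle_dominates_def by (meson hd_in_set last_in_set)+
        then have "list_cycle R (d @ e @ g)"
          using less.prems(3)[OF F(1)] less.prems(3)[OF F(2)] less.prems(3)[OF F(3)] dg
          by (auto simp: list_cycle_def successively_append_iff)
        moreover have "set (d @ e @ g) = (\<Union>d\<in>{d, e, g}. set d)" by auto
        moreover have "2 \<le> card {d, e, g}" using neq by (auto simp: card_insert_if)
        ultimately show False using no F by (metis empty_subsetI insert_subset)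
      qed
    qed (use dom in blast)
    then obtain m where m: "m \<in> F" "\<And>d. d \<in> F \<Longrightarrow> d \<noteq> m \<Longrightarrow> cycle_dominates R m d" by blast
    show ?thesis
    proof (cases "F = {m}")
      case True
      with less.prems(3) show ?thesis by auto
    next
      case False
      with m(1) obtain d where d: "d \<in> F" "d \<noteq> m" by blast
      \<comment> \<open>Applying \<open>cut\<close> to the parts met by \<open>m\<close> yields an
        arc that enters \<open>m\<close> from another cycle, although \<open>m\<close> dominates all
        of them.\<close>
      let ?U = "\<tau> ` set m"
      have "hd d \<in> set d" using ne[OF d(1)] by simp
      then have "\<tau> (hd d) \<in> W - ?U" using d m(1) type_neq[OF d(1) m(1) d(2)] W by blast
      then have "?U \<subset> W" using W m(1) by blast
      then obtain a y where ay: "a \<in> W - ?U" "y \<in> set m" "(a, \<tau> y) \<in> A"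
        using cut[of ?U] ne[OF m(1)] by auto
      then obtain x e where x: "a = \<tau> x" "x \<in> set e" "e \<in> F" using less.prems(5) by blast
      with ay have "e \<noteq> m" by auto
      with m(2)[OF x(3)] x ay show ?thesis by (auto simp: cycle_dominates_def R_def)
    qed
  qed
qed

section \<open>Translation between cycles as arc lists and as vertex lists\<close>

abbreviation arc_rel :: "'a pair_pre_digraph \<Rightarrow> 'a \<Rightarrow> 'a \<Rightarrow> bool" where
  "arc_rel G x y \<equiv> (x, y) \<in> parcs G"

lemma pawalk_verts_eq: "pcas u c v \<Longrightarrow> pawalk_verts u c = map fst c @ [v]"
  by (induction c arbitrary: u) auto

lemma pcas_successively:
  "pcas u c v \<Longrightarrow> set c \<subseteq> A \<Longrightarrow>
     successively (\<lambda>x y. (x, y) \<in> A) (map fst c @ [v]) \<and> hd (map fst c @ [v]) = u"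
  by (induction c arbitrary: u) (auto simp: successively_Cons)

lemma successively_zip_arcs:
  "successively (\<lambda>x y. (x, y) \<in> A) (x # xs @ [v]) \<Longrightarrow>
     pcas x (zip (x # xs) (xs @ [v])) v \<and> set (zip (x # xs) (xs @ [v])) \<subseteq> A"
  by (induction xs arbitrary: x) auto

lemma dicycle_imp_list_cycle:
  assumes "dicycle G c" shows "list_cycle (arc_rel G) (map fst c)"
proof -
  from assms obtain u where u: "set c \<subseteq> parcs G" "pcas u c u"
    "distinct (tl (pawalk_verts u c))" "c \<noteq> []"
    by (auto simp: dicycle_def pre_digraph.cycle_def pre_digraph.awalk_def
        cas_with_proj_eq awalk_verts_with_proj_eq)
  obtain l where l: "map fst c = u # l"
    using u pcas_successively[OF u(2,1)] by (cases c) auto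
  \<comment> \<open>The closed walk lists \<open>u\<close> at both ends, and its tail drops the
    first copy.\<close>
  have "distinct (l @ [u])" using u(3) by (simp add: pawalk_verts_eq[OF u(2)] l)
  moreover have "successively (arc_rel G) ((u # l) @ [u])"
    using pcas_successively[OF u(2,1)] l by simp
  ultimately show ?thesis unfolding l list_cycle_def successively_append_iff by auto
qed

lemma list_cycle_imp_dicycle:
  assumes "list_cycle (arc_rel G) l" "2 \<le> length l" "set l \<subseteq> pverts G"
  shows "\<exists>c. dicycle G c \<and> cycle_verts c = set l"
proof -
  obtain x xs where l: "l = x # xs" using assms(2) by (cases l) auto
  let ?c = "zip (x # xs) (xs @ [x])"
  have "successively (arc_rel G) ((x # xs) @ [x])"
    unfolding successively_append_iff using assms(1) l by (simp add: list_cycle_def)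
  then have z: "pcas x ?c x" "set ?c \<subseteq> parcs G"
    using successively_zip_arcs[of "parcs G" x xs x] by auto
  have f: "map fst ?c = l" by (simp add: l)
  have "distinct (tl (pawalk_verts x ?c))"
    unfolding pawalk_verts_eq[OF z(1)] f using assms(1) by (auto simp: l list_cycle_def)
  then have "dicycle G ?c"
    using z assms l
    by (auto simp: dicycle_def pre_digraph.cycle_def pre_digraph.awalk_def
        cas_with_proj_eq awalk_verts_with_proj_eq)
  moreover have "cycle_verts ?c = set l" unfolding cycle_verts_def by (metis f set_map)
  ultimately show ?thesis by blast
qed

lemma list_cycle_length:
  assumes "list_cycle R l" "\<And>x. x \<in> set l \<Longrightarrow> \<not> R x x" shows "2 \<le> length l"
proof (rule ccontr)
  assume "\<not> ?thesis"
  with assms(1) obtain x where "l = [x]"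
    by (cases l) (auto simp: list_cycle_def Suc_le_eq)
  with assms show False by (auto simp: list_cycle_def)
qed

lemma list_cycle_mono:
  assumes "list_cycle R l" "\<And>x y. x \<in> set l \<Longrightarrow> y \<in> set l \<Longrightarrow> R x y \<Longrightarrow> S x y"
  shows "list_cycle S l"
  using assms unfolding list_cycle_iff by (meson cyc_arc_in_set)

section \<open>Expanding vertices to paths and cutting lists into blocks\<close>

lemma hd_concat_map: "xs \<noteq> [] \<Longrightarrow> (\<And>x. x \<in> set xs \<Longrightarrow> g x \<noteq> []) \<Longrightarrow>
    hd (concat (map g xs)) = hd (g (hd xs))"
  by (cases xs) auto

lemma last_concat_map: "xs \<noteq> [] \<Longrightarrow> (\<And>x. x \<in> set xs \<Longrightarrow> g x \<noteq> []) \<Longrightarrow>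
    last (concat (map g xs)) = last (g (last xs))"
  by (induction xs rule: rev_induct) auto

text \<open>The expansion of a cycle: each vertex \<open>x\<close> is replaced by the path
  \<open>g x\<close>, and an arc of \<open>R\<close> becomes the arc from the end of one path to the
  start of the next.\<close>

lemma list_cycle_concat_map:
  assumes c: "list_cycle R c"
    and ne: "\<And>x. x \<in> set c \<Longrightarrow> g x \<noteq> [] \<and> distinct (g x) \<and> successively S (g x)"
    and disj: "\<And>x y. x \<in> set c \<Longrightarrow> y \<in> set c \<Longrightarrow> x \<noteq> y \<Longrightarrow> set (g x) \<inter> set (g y) = {}"
    and RS: "\<And>x y. x \<in> set c \<Longrightarrow> y \<in> set c \<Longrightarrow> R x y \<Longrightarrow> S (last (g x)) (hd (g y))"
  shows "list_cycle S (concat (map g c))"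
proof -
  have "successively S (concat (map g xs)) \<and> distinct (concat (map g xs))"
    if "set xs \<subseteq> set c" "successively R xs" "distinct xs" for xs
    using that
  proof (induction xs)
    case (Cons x xs)
    have IH: "successively S (concat (map g xs))" "distinct (concat (map g xs))"
      using Cons by (auto simp: successively_Cons)
    have x: "x \<in> set c" using Cons.prems by auto
    have "S (last (g x)) (hd (concat (map g xs)))" if "xs \<noteq> []"
    proof -
      have "hd xs \<in> set c" using that Cons.prems by auto
      moreover have "R x (hd xs)" using that Cons.prems by (auto simp: successively_Cons)
      moreover have "hd (concat (map g xs)) = hd (g (hd xs))"
        by (rule hd_concat_map[OF that]) (use ne Cons.prems in auto)
      ultimately show ?thesis using RS[OF x] by auto
    qed
    then have "successively S (concat (map g (x # xs)))"
      using IH ne[OF x] by (cases "xs = []") (auto simp: successively_append_iff)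
    moreover have "set (g x) \<inter> set (concat (map g xs)) = {}"
      using disj[OF x] Cons.prems by fastforce
    ultimately show ?case using IH ne[OF x] by simp
  qed simp
  moreover have "S (last (concat (map g c))) (hd (concat (map g c)))"
    using c ne RS by (simp add: list_cycle_def hd_concat_map last_concat_map)
  moreover have "concat (map g c) \<noteq> []" using c ne by (cases c) (auto simp: list_cycle_def)
  ultimately show ?thesis using c by (auto simp: list_cycle_def)
qed

lemma successively_const:
  assumes "successively R l" "\<And>x y. R x y \<Longrightarrow> f x = f y" "z \<in> set l"
  shows "f z = f (hd l)"
  using assms(1,3)
proof (induction l)
  case (Cons a l)
  show ?case
  proof (cases "z = a")
    case False
    with Cons.prems have "l \<noteq> []" "z \<in> set l" by auto
    with Cons.prems(1) have "R a (hd l)" "successively R l" by (auto simp: successively_Cons)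
    from Cons.IH[OF this(2) \<open>z \<in> set l\<close>] assms(2)[OF this(1)] show ?thesis by simp
  qed simp
qed simp

text \<open>Going backwards through the list, a step in \<open>I\<close> extends the first block and
  a step in \<open>E\<close> opens a new one. In the application, \<open>I\<close> stands for arcs
  inside the parts and \<open>E\<close> for arcs coming from \<open>T\<close>.\<close>

lemma successively_blocks:
  assumes "successively S l" "l \<noteq> []" "\<And>x y. x \<in> set l \<Longrightarrow> y \<in> set l \<Longrightarrow> S x y \<Longrightarrow> I x y \<or> E x y"
  shows "\<exists>B. concat B = l \<and> (\<forall>b\<in>set B. b \<noteq> [] \<and> successively I b) \<and>
    successively (\<lambda>b b'. E (last b) (hd b')) B"
  using assms
proof (induction l)
  case (Cons x l)
  show ?case
  proof (cases "l = []")
    case True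
    then show ?thesis by (intro exI[of _ "[[x]]"]) auto
  next
    case False
    with Cons obtain B where B: "concat B = l" "\<forall>b\<in>set B. b \<noteq> [] \<and> successively I b"
        "successively (\<lambda>b b'. E (last b) (hd b')) B"
      by (auto simp: successively_Cons)
    then obtain b B' where BB: "B = b # B'" using False by (cases B) auto
    have hd: "hd l = hd b" using B BB by auto
    have "I x (hd l) \<or> E x (hd l)" using Cons.prems False by (auto simp: successively_Cons)
    then show ?thesis
    proof
      assume "I x (hd l)"
      then show ?thesis using B BB hd
        by (intro exI[of _ "(x # b) # B'"]) (auto simp: successively_Cons)
    next
      assume "E x (hd l)"
      then show ?thesis using B BB hd
        by (intro exI[of _ "[x] # B"]) (auto simp: successively_Cons)
    qed
  qed
qed simp

section \<open>Path covers of prescribed size\<close>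

lemma vpath_iff:
  "vpath p (with_proj G) \<longleftrightarrow> p \<noteq> [] \<and> distinct p \<and> set p \<subseteq> pverts G \<and> successively (arc_rel G) p"
proof -
  have "set (vwalk_arcs p) \<subseteq> parcs G \<longleftrightarrow> successively (arc_rel G) p"
    by (induction p rule: vwalk_arcs.induct) auto
  then show ?thesis by (auto simp: vpath_def vwalk_def)
qed

text \<open>With fewer paths than vertices, some path has at least two vertices; its first vertex is
  split off as a path of its own.\<close>

lemma path_cover_refine:
  assumes P: "path_cover G P" and lt: "card P < card (pverts G)"
  shows "\<exists>P'. path_cover G P' \<and> card P' = Suc (card P)"
proof -
  have fin: "finite P" and vp: "\<And>p. p \<in> P \<Longrightarrow> vpath p (with_proj G)"
    and un: "(\<Union>p\<in>P. set p) = pverts G"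
    using P by (auto simp: path_cover_def)
  have dj: "set p \<inter> set q = {}" if "p \<in> P" "q \<in> P" "p \<noteq> q" for p q
    using P that unfolding path_cover_def disjoint_family_on_def by blast
  have "\<exists>p\<in>P. 2 \<le> length p"
  proof (rule ccontr)
    assume "\<not> ?thesis"
    then have short: "length p < 2" if "p \<in> P" for p using that by auto
    have "pverts G \<subseteq> hd ` P"
    proof
      fix x assume "x \<in> pverts G"
      then obtain p where "p \<in> P" "x \<in> set p" using un by blast
      moreover then have "p = [x]" using short[of p] by (cases p) auto
      ultimately show "x \<in> hd ` P" by force
    qed
    then have "card (pverts G) \<le> card P"
      by (meson fin surj_card_le)
    with lt show False by simp
  qed
  then obtain x q where p: "x # q \<in> P" "q \<noteq> []"
    by (metis Suc_le_length_iff list.distinct(1) numeral_2_eq_2)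
  let ?P = "insert [x] (insert q (P - {x # q}))"
  have vq: "vpath q (with_proj G)" "x \<notin> set q" "vpath [x] (with_proj G)"
    using vp[OF p(1)] p(2) by (auto simp: vpath_iff successively_Cons)
  have dq: "set r \<inter> set (x # q) = {}" if "r \<in> P - {x # q}" for r
    using dj[of r "x # q"] that p(1) by blast
  \<comment> \<open>Both pieces meet \<open>x # q\<close>, so neither is another path of the cover,
    and the number of paths really grows by one.\<close>
  have notin: "[x] \<notin> P - {x # q}" "q \<notin> P - {x # q}"
    using dq[of "[x]"] dq[of q] p(2) by auto
  have "path_cover G ?P"
    unfolding path_cover_def
  proof (intro conjI)
    show "disjoint_family_on set ?P"
      unfolding disjoint_family_on_def using dq vq(2) dj by fastforce
    have "(\<Union>p\<in>?P. set p) = (\<Union>p\<in>insert (x # q) (P - {x # q}). set p)" by auto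
    also have "\<dots> = pverts G" using un p(1) by (simp add: insert_absorb)
    finally show "(\<Union>p\<in>?P. set p) = pverts G" .
  qed (use fin vp vq in auto)
  moreover have "card ?P = Suc (card P)"
  proof -
    have "[x] \<noteq> q" using vq by auto
    then have "card ?P = Suc (Suc (card (P - {x # q})))" using notin fin by simp
    also have "\<dots> = Suc (card P)" using card_Suc_Diff1[OF fin p(1)] by simp
    finally show ?thesis .
  qed
  ultimately show ?thesis by blast
qed

text \<open>The cover by single vertices shows that the minimum is taken over a nonempty set, hence
  attained.\<close>

lemma path_cover_exists:
  assumes "finite (pverts G)"
  shows "\<exists>P. path_cover G P \<and> card P = path_covering_number G"
proof -
  have "path_cover G ((\<lambda>x. [x]) ` pverts G)"
    using assms by (auto simp: path_cover_def vpath_iff disjoint_family_on_def)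
  then have "\<exists>k P. path_cover G P \<and> card P = k" by blast
  then show ?thesis unfolding path_covering_number_def by (rule LeastI_ex)
qed

lemma path_covering_number_le: "path_cover G P \<Longrightarrow> path_covering_number G \<le> card P"
  unfolding path_covering_number_def by (rule Least_le) blast

text \<open>Guarantees that the covering condition makes the cycles meet every part.\<close>

lemma path_covering_number_pos:
  assumes "finite (pverts G)" "pverts G \<noteq> {}" shows "0 < path_covering_number G"
proof -
  obtain P where P: "path_cover G P" "card P = path_covering_number G"
    using path_cover_exists[OF assms(1)] by blast
  then have "P \<noteq> {}" "finite P" using assms(2) by (auto simp: path_cover_def)
  with P show ?thesis by (metis card_gt_0_iff)
qed

text \<open>A minimum cover is refined one path at a time. This handles cycles that cover more than
  \<open>path_covering_number G\<close> vertices of a part.\<close>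

lemma path_cover_of_card:
  assumes "finite (pverts G)" "path_covering_number G \<le> m" "m \<le> card (pverts G)"
  shows "\<exists>P. path_cover G P \<and> card P = m"
  using assms(2,3)
proof (induction m rule: dec_induct)
  case base
  show ?case using path_cover_exists[OF assms(1)] .
next
  case (step m)
  then show ?case using path_cover_refine[of G] by (metis Suc_le_lessD less_imp_le)
qed

section \<open>Parts and arcs of a composition\<close>

text \<open>Disjointness of the parts makes this meaningful on the vertices of a composition;
  elsewhere the value is unspecified.\<close>

definition part :: "'a pair_pre_digraph \<Rightarrow> ('a \<Rightarrow> 'b pair_pre_digraph) \<Rightarrow> 'b \<Rightarrow> 'a" where
  "part T H x = (THE u. u \<in> pverts T \<and> x \<in> pverts (H u))"

lemma part_eq:
  assumes "composition_data T H" "u \<in> pverts T" "x \<in> pverts (H u)"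
  shows "part T H x = u"
  unfolding part_def
proof (rule the_equality)
  fix v assume "v \<in> pverts T \<and> x \<in> pverts (H v)"
  with assms show "v = u" unfolding composition_data_def disjoint_family_on_def by blast
qed (use assms in auto)

lemma composition_part:
  assumes "composition_data T H" "x \<in> pverts (composition T H)"
  shows "part T H x \<in> pverts T" "x \<in> pverts (H (part T H x))"
  using assms part_eq[OF assms(1)] by (auto simp: composition_def)

text \<open>Vertex membership is stated explicitly because \<open>part\<close> is unspecified
  elsewhere; for an arc of some \<open>H u\<close> it follows from well-formedness.\<close>

lemma arc_composition_iff:
  assumes "composition_data T H"
  shows "arc_rel (composition T H) x y \<longleftrightarrow>
    x \<in> pverts (composition T H) \<and> y \<in> pverts (composition T H) \<and>
    ((part T H x = part T H y \<and> arc_rel (H (part T H x)) x y) \<or>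
      arc_rel T (part T H x) (part T H y))"
    (is "?L \<longleftrightarrow> ?R")
proof
  assume ?L
  then consider u where "u \<in> pverts T" "arc_rel (H u) x y"
    | u v where "u \<in> pverts T" "v \<in> pverts T" "x \<in> pverts (H u)" "y \<in> pverts (H v)" "arc_rel T u v"
    by (auto simp: composition_def)
  then show ?R
  proof cases
    case 1
    then have "pair_digraph (H u)" using assms by (simp add: composition_data_def)
    then have "pair_wf_digraph (H u)" by (simp add: pair_digraph_def pair_fin_digraph_def)
    then have "x \<in> pverts (H u)" "y \<in> pverts (H u)"
      using 1(2) by (auto dest: pair_wf_digraph.wellformed')
    with 1 part_eq[OF assms 1(1)] show ?thesis by (auto simp: composition_def)
  next
    case 2
    with part_eq[OF assms 2(1,3)] part_eq[OF assms 2(2,4)] show ?thesis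
      by (auto simp: composition_def)
  qed
next
  assume ?R
  with composition_part[OF assms, of x] composition_part[OF assms, of y] show ?L
    unfolding composition_def by auto
qed

lemma composition_dataD:
  assumes "composition_data T H"
  shows "finite (pverts T)" "\<And>u. \<not> arc_rel T u u"
    "\<And>u. u \<in> pverts T \<Longrightarrow> finite (pverts (H u))" "\<And>u. u \<in> pverts T \<Longrightarrow> pverts (H u) \<noteq> {}"
    "2 \<le> card (pverts T)" "finite (pverts (composition T H))"
proof -
  have pd: "pair_digraph T" "\<And>u. u \<in> pverts T \<Longrightarrow> pair_digraph (H u)"
    using assms by (auto simp: composition_data_def)
  show fT: "finite (pverts T)" using pd(1)
    by (simp add: pair_digraph_def pair_fin_digraph_def pair_fin_digraph_axioms_def)
  show "\<And>u. \<not> arc_rel T u u" using pd(1)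
    by (force simp: pair_digraph_def pair_loopfree_digraph_def pair_loopfree_digraph_axioms_def)
  show fH: "\<And>u. u \<in> pverts T \<Longrightarrow> finite (pverts (H u))" using pd(2)
    by (simp add: pair_digraph_def pair_fin_digraph_def pair_fin_digraph_axioms_def)
  show "finite (pverts (composition T H))" using fT fH by (simp add: composition_def)
qed (use assms in \<open>auto simp: composition_data_def\<close>)

lemma composition_no_loops:
  assumes "composition_data T H" shows "\<not> arc_rel (composition T H) x x"
proof
  assume a: "arc_rel (composition T H) x x"
  then have "part T H x \<in> pverts T" "arc_rel (H (part T H x)) x x"
    using composition_part(1)[OF assms, of x] composition_dataD(2)[OF assms]
    by (auto simp: arc_composition_iff[OF assms])
  with assms show False
    by (force simp: composition_data_def pair_digraph_def pair_loopfree_digraph_def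
        pair_loopfree_digraph_axioms_def)
qed

text \<open>On a path from a part outside \<open>U\<close> to a part in \<open>U\<close>, arcs of
  the \<open>H u\<close> stay in their part, so an arc of \<open>T\<close> must enter
  \<open>U\<close>.\<close>

lemma composition_strong_cut:
  assumes data: "composition_data T H"
    and strong: "strongly_connected (with_proj (composition T H))"
    and U: "U \<noteq> {}" "U \<subset> pverts T"
  shows "\<exists>a\<in>pverts T - U. \<exists>b\<in>U. (a, b) \<in> parcs T"
proof (rule ccontr)
  assume no: "\<not> ?thesis"
  obtain a b where ab: "a \<in> pverts T" "a \<notin> U" "b \<in> U" "b \<in> pverts T" using U by blast
  then obtain x y where xy: "x \<in> pverts (H a)" "y \<in> pverts (H b)"
    using composition_dataD(4)[OF data] by blast
  let ?Q = "composition T H"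
  have Q: "x \<in> pverts ?Q" "y \<in> pverts ?Q" using xy ab by (auto simp: composition_def)
  then have "reachable (with_proj ?Q) x y" using strong by (auto simp: strongly_connected_def)
  then have "(x, y) \<in> (parcs ?Q)\<^sup>*" using reachable_rtranclI by fastforce
  then have "part T H y \<notin> U"
  proof (induction rule: rtrancl_induct)
    case base
    show ?case using part_eq[OF data ab(1) xy(1)] ab by simp
  next
    case (step z w)
    from step.hyps(2) have "z \<in> pverts ?Q"
      "part T H z = part T H w \<or> arc_rel T (part T H z) (part T H w)"
      unfolding arc_composition_iff[OF data] by auto
    with step.IH no composition_part(1)[OF data] show ?case by fastforce
  qed
  then show False using part_eq[OF data ab(4) xy(2)] ab by simp
qed

section \<open>The two directions of the equivalence\<close>

lemma hamiltonian_imp_covering_cycle: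
  assumes dH: "composition_data T H" and dK: "composition_data T K"
    and card_eq: "\<And>u. u \<in> pverts T \<Longrightarrow> card (pverts (K u)) = card (pverts (H u))"
    and ham: "hamiltonian_cycle (composition T H) c"
  shows "\<exists>d. dicycle (composition T K) d \<and>
    (\<forall>u\<in>pverts T. path_covering_number (H u) \<le> card (pverts (K u) \<inter> cycle_verts d))"
proof -
  let ?Q = "composition T H" and ?\<tau> = "part T H"
  let ?l = "map fst c"
  have l: "list_cycle (arc_rel ?Q) ?l" "set ?l = pverts ?Q"
    using ham dicycle_imp_list_cycle by (auto simp: hamiltonian_cycle_def cycle_verts_def)
  \<comment> \<open>The cycle is cut open at an arc between different parts, so that no block is
    broken by the ends of the list. Such an arc exists because the cycle visits at least two
    parts.\<close>
  have "\<exists>x y. cyc_arc ?l x y \<and> ?\<tau> x \<noteq> ?\<tau> y"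
  proof (rule ccontr)
    assume "\<not> ?thesis"
    then have const: "?\<tau> x = ?\<tau> y" if "cyc_arc ?l x y" for x y using that by blast
    have "\<not> is_singleton (pverts T)" "pverts T \<noteq> {}"
      using composition_dataD(5)[OF dH] by (auto simp: is_singleton_altdef)
    then obtain a b where ab: "a \<in> pverts T" "b \<in> pverts T" "a \<noteq> b"
      by (metis is_singletonI' )
    then obtain v w where vw: "v \<in> pverts (H a)" "w \<in> pverts (H b)"
      using composition_dataD(4)[OF dH] by blast
    have "v \<in> set ?l" "w \<in> set ?l" using vw ab l(2) by (auto simp: composition_def)
    then have "w \<in> {z. ?\<tau> z = ?\<tau> v}"
      using cyc_arc_closed_set[of v ?l "{z. ?\<tau> z = ?\<tau> v}"] const by auto
    with part_eq[OF dH ab(1) vw(1)] part_eq[OF dH ab(2) vw(2)] ab show False by simp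
  qed
  then obtain x y where xy: "cyc_arc ?l x y" "?\<tau> x \<noteq> ?\<tau> y" by blast
  from list_cycle_rotate_to_arc[OF l(1) xy(1)] obtain k where
    k: "list_cycle (arc_rel ?Q) k" "set k = pverts ?Q" "hd k = y" "last k = x" using l(2) by metis
  define I where "I = (\<lambda>x y. ?\<tau> x = ?\<tau> y \<and> arc_rel (H (?\<tau> x)) x y)"
  define E where "E = (\<lambda>x y. arc_rel T (?\<tau> x) (?\<tau> y))"
  have IE: "I v w \<or> E v w" if "arc_rel ?Q v w" for v w
    using that unfolding arc_composition_iff[OF dH] I_def E_def by blast
  have kE: "E (last k) (hd k)"
    using k IE[of x y] xy(2) by (auto simp: list_cycle_def I_def)
  have "\<exists>B. concat B = k \<and> (\<forall>b\<in>set B. b \<noteq> [] \<and> successively I b) \<and>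
      successively (\<lambda>b b'. E (last b) (hd b')) B"
    by (rule successively_blocks[of "arc_rel ?Q"]) (use k(1) IE in \<open>simp_all add: list_cycle_def\<close>)
  then obtain B where B: "concat B = k" "\<forall>b\<in>set B. b \<noteq> [] \<and> successively I b"
      "successively (\<lambda>b b'. E (last b) (hd b')) B"
    by blast
  have Bne: "B \<noteq> []" using B(1) k(1) by (auto simp: list_cycle_def)
  have "set (concat B) = pverts ?Q" unfolding B(1) k(2) ..
  then have bsub: "set b \<subseteq> pverts ?Q" if "b \<in> set B" for b using that unfolding set_concat by blast
  have dk: "distinct (concat B)" using k(1) B(1) by (simp add: list_cycle_def)
  have dB: "distinct B" "\<And>b. b \<in> set B \<Longrightarrow> distinct b"
      "\<And>b b'. b \<in> set B \<Longrightarrow> b' \<in> set B \<Longrightarrow> b \<noteq> b' \<Longrightarrow> set b \<inter> set b' = {}"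
    using dk B(2) by (auto simp: distinct_concat_iff)
  \<comment> \<open>All of the block \<open>b\<close> lies in the part \<open>\<beta> b\<close>,
    since arcs in \<open>I\<close> do not change the part.\<close>
  define \<beta> where "\<beta> b = ?\<tau> (hd b)" for b
  have b_part: "\<forall>z\<in>set b. ?\<tau> z = \<beta> b" if "b \<in> set B" for b
  proof -
    have "?\<tau> z = ?\<tau> (hd b)" if "z \<in> set b" for z
      by (rule successively_const[of I b]) (use B(2) \<open>b \<in> set B\<close> that in \<open>auto simp: I_def\<close>)
    then show ?thesis by (simp add: \<beta>_def)
  qed
  define Bu where "Bu u = {b \<in> set B. \<beta> b = u}" for u
  have cover: "path_cover (H u) (Bu u)" if u: "u \<in> pverts T" for u
    unfolding path_cover_def
  proof (intro conjI ballI)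
    show "finite (Bu u)" by (simp add: Bu_def)
    show "disjoint_family_on set (Bu u)"
      using dB(3) by (auto simp: disjoint_family_on_def Bu_def)
    fix b assume b: "b \<in> Bu u"
    then have bB: "b \<in> set B" and zu: "\<forall>z\<in>set b. ?\<tau> z = u" using b_part by (auto simp: Bu_def)
    have "z \<in> pverts (H u)" if "z \<in> set b" for z
      using bsub[OF bB] zu composition_part(2)[OF dH, of z] that by auto
    then have "set b \<subseteq> pverts (H u)" by (rule subsetI)
    moreover have "successively (arc_rel (H u)) b"
      by (rule successively_mono[of I]) (use B(2) bB zu in \<open>auto simp: I_def\<close>)
    ultimately show "vpath b (with_proj (H u))" using B(2) bB dB(2) by (auto simp: vpath_iff)
  next
    show "(\<Union>b\<in>Bu u. set b) = pverts (H u)"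
    proof (intro equalityI subsetI)
      fix z assume "z \<in> (\<Union>b\<in>Bu u. set b)"
      then obtain b where "b \<in> set B" "\<beta> b = u" "z \<in> set b" by (auto simp: Bu_def)
      then show "z \<in> pverts (H u)" using b_part bsub composition_part(2)[OF dH, of z] by auto
    next
      fix z assume z: "z \<in> pverts (H u)"
      then have "z \<in> set (concat B)" using B(1) k(2) u by (auto simp: composition_def)
      then obtain b where "b \<in> set B" "z \<in> set b" by auto
      moreover then have "\<beta> b = u" using b_part part_eq[OF dH u z] by auto
      ultimately show "z \<in> (\<Union>b\<in>Bu u. set b)" by (auto simp: Bu_def)
    qed
  qed
  \<comment> \<open>The first vertices of the blocks are distinct vertices of \<open>H u\<close>, so
    there are enough vertices in \<open>K u\<close> to contract the blocks injectively.\<close>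
  have "\<exists>f. f ` Bu u \<subseteq> pverts (K u) \<and> inj_on f (Bu u)" if u: "u \<in> pverts T" for u
  proof (rule card_le_inj)
    have ne: "hd b \<in> set b" if "b \<in> Bu u" for b using that B(2) by (simp add: Bu_def)
    have "inj_on hd (Bu u)"
    proof (rule inj_onI)
      fix b b' assume b: "b \<in> Bu u" "b' \<in> Bu u" "hd b = hd b'"
      show "b = b'"
        using ne[OF b(1)] ne[OF b(2)] b dB(3)[of b b'] by (auto simp: Bu_def)
    qed
    moreover have "hd ` Bu u \<subseteq> pverts (H u)"
      using cover[OF u] ne by (fastforce simp: path_cover_def)
    ultimately have "card (Bu u) \<le> card (pverts (H u))"
      using composition_dataD(3)[OF dH u] card_inj_on_le by blast
    then show "card (Bu u) \<le> card (pverts (K u))" using card_eq[OF u] by simp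
  qed (use composition_dataD(3)[OF dK u] in \<open>auto simp: Bu_def\<close>)
  then obtain f where f: "\<And>u. u \<in> pverts T \<Longrightarrow> f u ` Bu u \<subseteq> pverts (K u) \<and> inj_on (f u) (Bu u)"
    by metis
  define g where "g b = f (\<beta> b) b" for b
  have \<beta>T: "\<beta> b \<in> pverts T" if "b \<in> set B" for b
    using that B(2) bsub composition_part(1)[OF dH] unfolding \<beta>_def by (meson hd_in_set subsetD)
  have gK: "g b \<in> pverts (K (\<beta> b))" if "b \<in> set B" for b
    using f[OF \<beta>T[OF that]] that by (auto simp: g_def Bu_def)
  have g\<beta>: "part T K (g b) = \<beta> b" if "b \<in> set B" for b
    using part_eq[OF dK \<beta>T[OF that] gK[OF that]] .
  have inj: "inj_on g (set B)"
  proof (rule inj_onI)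
    fix b b' assume b: "b \<in> set B" "b' \<in> set B" "g b = g b'"
    then have "\<beta> b = \<beta> b'" using g\<beta> by metis
    with b f[OF \<beta>T[OF b(1)]] show "b = b'" by (auto simp: g_def Bu_def inj_on_def)
  qed
  have gV: "set (map g B) \<subseteq> pverts (composition T K)"
    using gK \<beta>T by (auto simp: composition_def)
  have arc: "arc_rel (composition T K) (g b) (g b')"
    if "b \<in> set B" "b' \<in> set B" "E (last b) (hd b')" for b b'
  proof -
    have "?\<tau> (last b) = \<beta> b" using b_part[OF that(1)] B(2) that(1) by simp
    then have "arc_rel T (\<beta> b) (\<beta> b')" using that(3) by (simp add: E_def \<beta>_def)
    then show ?thesis
      using gV that g\<beta> unfolding arc_composition_iff[OF dK] by auto
  qed
  have lc: "list_cycle (arc_rel (composition T K)) (map g B)"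
    unfolding list_cycle_def
  proof (intro conjI)
    show "successively (arc_rel (composition T K)) (map g B)"
      unfolding successively_map by (rule successively_mono[OF B(3)]) (use arc in blast)
    have "last k = last (last B)" "hd k = hd (hd B)"
      using last_concat_map[of B id] hd_concat_map[of B id] B Bne by auto
    then have "E (last (last B)) (hd (hd B))" using kE by simp
    from arc[OF _ _ this] Bne
    show "arc_rel (composition T K) (last (map g B)) (hd (map g B))" by (simp add: last_map hd_map)
  qed (use dB inj Bne in \<open>auto simp: distinct_map\<close>)
  obtain d where d: "dicycle (composition T K) d" "cycle_verts d = set (map g B)"
    using list_cycle_imp_dicycle[OF lc list_cycle_length[OF lc] gV] composition_no_loops[OF dK]
    by blast
  have "path_covering_number (H u) \<le> card (pverts (K u) \<inter> cycle_verts d)" if u: "u \<in> pverts T" for u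
  proof -
    have "card (Bu u) = card (g ` Bu u)"
      using inj by (simp add: Bu_def card_image inj_on_def)
    also have "\<dots> \<le> card (pverts (K u) \<inter> cycle_verts d)"
      by (rule card_mono) (use composition_dataD(3)[OF dK u] d(2) gK in \<open>auto simp: Bu_def\<close>)
    finally show ?thesis using path_covering_number_le[OF cover[OF u]] by simp
  qed
  with d(1) show ?thesis by blast
qed

lemma covering_cycles_imp_hamiltonian:
  assumes dH: "composition_data T H" and dK: "composition_data T K" and semi: "semicomplete T"
    and strong: "strongly_connected (with_proj (composition T H))"
    and card_eq: "\<And>u. u \<in> pverts T \<Longrightarrow> card (pverts (K u)) = card (pverts (H u))"
    and edgeless: "\<And>u. u \<in> pverts T \<Longrightarrow> parcs (K u) = {}"
    and C: "cycle_subdigraph (composition T K) C"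
    and pc: "\<And>u. u \<in> pverts T \<Longrightarrow>
      path_covering_number (H u) \<le> card (pverts (K u) \<inter> (\<Union>c\<in>C. cycle_verts c))"
  shows "\<exists>c. hamiltonian_cycle (composition T H) c"
proof -
  let ?Q = "composition T H" and ?Q' = "composition T K" and ?\<tau> = "part T K"
  define V where "V = (\<Union>c\<in>C. cycle_verts c)"
  define F where "F = map fst ` C"
  define R where "R = (\<lambda>x y. arc_rel T (?\<tau> x) (?\<tau> y))"
  \<comment> \<open>As the \<open>K u\<close> have no arcs, every arc of \<open>?Q'\<close> comes
    from \<open>T\<close>, and adjacency can be read off from the parts.\<close>
  have arc': "arc_rel ?Q' x y \<Longrightarrow> x \<in> pverts ?Q' \<and> R x y" for x y
    using edgeless composition_part(1)[OF dK, of x] by (auto simp: arc_composition_iff[OF dK] R_def)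
  have lcF: "list_cycle (arc_rel ?Q') d" if "d \<in> F" for d
    using that C dicycle_imp_list_cycle by (auto simp: F_def cycle_subdigraph_def)
  have subF: "set d \<subseteq> pverts ?Q'" if "d \<in> F" for d
    using lcF[OF that] cyc_arc_successor arc' unfolding list_cycle_iff by (metis subsetI)
  have FV: "(\<Union>d\<in>F. set d) = V" by (auto simp: F_def V_def cycle_verts_def)
  then have VQ: "V \<subseteq> pverts ?Q'" using subF by blast
  have W: "?\<tau> ` V = pverts T"
  proof (intro equalityI subsetI)
    fix u assume u: "u \<in> pverts T"
    have "0 < card (pverts (K u) \<inter> V)"
      using path_covering_number_pos[of "H u"] composition_dataD(3,4)[OF dH u] pc[OF u]
      by (simp add: V_def)
    then obtain x where "x \<in> pverts (K u)" "x \<in> V" by (auto simp: card_gt_0_iff)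
    then show "u \<in> ?\<tau> ` V" using part_eq[OF dK u] by force
  qed (use VQ composition_part(1)[OF dK] in blast)
  have "\<exists>c. list_cycle R c \<and> set c = (\<Union>d\<in>F. set d)"
    unfolding R_def
  proof (rule list_cycle_factor_imp_hamiltonian[where W = "pverts T"])
    show "a \<in> pverts T \<Longrightarrow> b \<in> pverts T \<Longrightarrow> a \<noteq> b \<Longrightarrow> arc_rel T a b \<or> arc_rel T b a" for a b
      using semi by (simp add: semicomplete_def)
    show "U \<noteq> {} \<Longrightarrow> U \<subset> pverts T \<Longrightarrow> \<exists>a\<in>pverts T - U. \<exists>b\<in>U. arc_rel T a b" for U
      by (rule composition_strong_cut[OF dH strong])
    \<comment> \<open>Only finitely many lists over a finite vertex set are free of
      repetitions.\<close>
    have "F \<subseteq> {xs. set xs \<subseteq> pverts ?Q' \<and> distinct xs}"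
      using subF lcF by (auto simp: list_cycle_def)
    then show "finite F"
      using finite_subset_distinct[OF composition_dataD(6)[OF dK]] finite_subset by blast
    show "F \<noteq> {}" using W FV composition_dataD(5)[OF dK] by auto
    show "list_cycle (\<lambda>x y. arc_rel T (?\<tau> x) (?\<tau> y)) d" if "d \<in> F" for d
      by (rule list_cycle_mono[OF lcF[OF that]]) (use arc' in \<open>auto simp: R_def\<close>)
    have "set (map fst d) \<inter> set (map fst e) = {}" if "d \<in> C" "e \<in> C" "d \<noteq> e" for d e
      using C that unfolding cycle_subdigraph_def disjoint_family_on_def cycle_verts_def set_map
      by blast
    then show "disjoint_family_on set F" unfolding disjoint_family_on_def F_def by blast
    show "?\<tau> ` (\<Union>d\<in>F. set d) = pverts T" using W FV by simp
  qed
  then obtain c where c: "list_cycle R c" "set c = V" using FV by auto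
  \<comment> \<open>The merged cycle has vertex set \<open>V\<close>, so the number of its vertices
    in part \<open>u\<close> lies between \<open>path_covering_number (H u)\<close> and the order of
    \<open>H u\<close>. A cover with exactly this many paths is matched with these vertices by
    \<open>h\<close>.\<close>
  have "\<exists>P h. path_cover (H u) P \<and> bij_betw h (pverts (K u) \<inter> V) P" if u: "u \<in> pverts T" for u
  proof -
    have fin: "finite (pverts (K u))" using composition_dataD(3)[OF dK u] .
    have "card (pverts (K u) \<inter> V) \<le> card (pverts (H u))"
      using card_eq[OF u] card_mono[OF fin, of "pverts (K u) \<inter> V"] by simp
    then obtain P where P: "path_cover (H u) P" "card P = card (pverts (K u) \<inter> V)"
      using path_cover_of_card[OF composition_dataD(3)[OF dH u] pc[OF u]] by (auto simp: V_def)
    then show ?thesis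
      using finite_same_card_bij[of "pverts (K u) \<inter> V" P] fin by (auto simp: path_cover_def)
  qed
  then obtain P h where
    Ph: "\<And>u. u \<in> pverts T \<Longrightarrow> path_cover (H u) (P u) \<and> bij_betw (h u) (pverts (K u) \<inter> V) (P u)"
    by metis
  define g where "g x = h (?\<tau> x) x" for x
  have \<tau>: "?\<tau> x \<in> pverts T" "x \<in> pverts (K (?\<tau> x)) \<inter> V" if "x \<in> V" for x
    using that VQ composition_part[OF dK] by blast+
  have gP: "g x \<in> P (?\<tau> x)" if "x \<in> V" for x
    using Ph[OF \<tau>(1)[OF that]] \<tau>(2)[OF that] by (auto simp: g_def bij_betw_def)
  have gp: "vpath (g x) (with_proj (H (?\<tau> x)))" if "x \<in> V" for x
    using Ph[OF \<tau>(1)[OF that]] gP[OF that] by (auto simp: path_cover_def)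
  then have g: "g x \<noteq> []" "distinct (g x)" "set (g x) \<subseteq> pverts (H (?\<tau> x))"
      "successively (arc_rel (H (?\<tau> x))) (g x)" if "x \<in> V" for x
    using that by (auto simp: vpath_iff)
  have lc: "list_cycle (arc_rel ?Q) (concat (map g c))"
  proof (rule list_cycle_concat_map[OF c(1)]; unfold c(2))
    fix x assume x: "x \<in> V"
    have "successively (arc_rel ?Q) (g x)"
      by (rule successively_mono[OF g(4)[OF x]]) (use \<tau>(1)[OF x] in \<open>auto simp: composition_def\<close>)
    then show "g x \<noteq> [] \<and> distinct (g x) \<and> successively (arc_rel ?Q) (g x)" using g[OF x] by simp
  next
    fix x y assume xy: "x \<in> V" "y \<in> V" "x \<noteq> y"
    show "set (g x) \<inter> set (g y) = {}"
    proof (cases "?\<tau> x = ?\<tau> y")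
      case True
      let ?u = "?\<tau> x"
      have "g x \<noteq> g y"
        using Ph[OF \<tau>(1)[OF xy(1)]] \<tau>(2)[OF xy(1)] \<tau>(2)[OF xy(2)] xy(3) True
        unfolding g_def bij_betw_def inj_on_def by metis
      then show ?thesis
        using Ph[OF \<tau>(1)[OF xy(1)]] gP[OF xy(1)] gP[OF xy(2)] True
        unfolding path_cover_def disjoint_family_on_def by metis
    next
      case False
      then have "pverts (H (?\<tau> x)) \<inter> pverts (H (?\<tau> y)) = {}"
        using dH \<tau>(1)[OF xy(1)] \<tau>(1)[OF xy(2)]
        unfolding composition_data_def disjoint_family_on_def by blast
      then show ?thesis using g(3)[OF xy(1)] g(3)[OF xy(2)] by blast
    qed
  next
    \<comment> \<open>An arc of \<open>T\<close> joins every vertex of one part to every vertex of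
      the other, whichever ends the chosen paths have.\<close>
    fix x y assume xy: "x \<in> V" "y \<in> V" "R x y"
    have "last (g x) \<in> pverts (H (?\<tau> x))" "hd (g y) \<in> pverts (H (?\<tau> y))"
      using g[OF xy(1)] g[OF xy(2)] by auto
    then show "arc_rel ?Q (last (g x)) (hd (g y))"
      using \<tau>(1)[OF xy(1)] \<tau>(1)[OF xy(2)] xy(3) by (auto simp: composition_def R_def)
  qed
  have "set (concat (map g c)) = (\<Union>x\<in>V. set (g x))" using c(2) by simp
  also have "\<dots> = pverts ?Q"
  proof (intro equalityI subsetI)
    fix z assume "z \<in> (\<Union>x\<in>V. set (g x))"
    then show "z \<in> pverts ?Q" using g(3) \<tau>(1) by (fastforce simp: composition_def)
  next
    fix z assume "z \<in> pverts ?Q"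
    then obtain u where u: "u \<in> pverts T" "z \<in> pverts (H u)" by (auto simp: composition_def)
    then obtain p where p: "p \<in> P u" "z \<in> set p" using Ph[OF u(1)] by (auto simp: path_cover_def)
    then obtain x where x: "x \<in> pverts (K u)" "x \<in> V" "p = h u x"
      using Ph[OF u(1)] by (auto simp: bij_betw_def)
    with p part_eq[OF dK u(1) x(1)] show "z \<in> (\<Union>x\<in>V. set (g x))" by (auto simp: g_def)
  qed
  finally have set_eq: "set (concat (map g c)) = pverts ?Q" .
  then show ?thesis
    using list_cycle_imp_dicycle[OF lc list_cycle_length[OF lc]] composition_no_loops[OF dH]
    unfolding hamiltonian_cycle_def by (metis order_refl)
qed

theorem theorem4p3:
  fixes T :: "'a pair_pre_digraph"
    and H :: "'a \<Rightarrow> 'b pair_pre_digraph"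
    and K :: "'a \<Rightarrow> 'c pair_pre_digraph"
    and n :: "'a \<Rightarrow> nat"
  assumes "composition_data T H"
    and "semicomplete T"
    and "strongly_connected (with_proj (composition T H))"
    and "\<And>u. u \<in> pverts T \<Longrightarrow> card (pverts (H u)) = n u"
    and "composition_data T K"
    and "\<And>u. u \<in> pverts T \<Longrightarrow> is_edgeless (n u) (K u)"
  shows "(\<exists>c. hamiltonian_cycle (composition T H) c) \<longleftrightarrow>
    (\<exists>C. cycle_subdigraph (composition T K) C \<and>
      (\<forall>u\<in>pverts T.
         path_covering_number (H u) \<le> card (pverts (K u) \<inter> (\<Union>c\<in>C. cycle_verts c))))"
proof -
  have K: "card (pverts (K u)) = card (pverts (H u))" "parcs (K u) = {}" if "u \<in> pverts T" for u
    using assms(4,6)[OF that] by (auto simp: is_edgeless_def)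
  show ?thesis
  proof
    assume "\<exists>c. hamiltonian_cycle (composition T H) c"
    then obtain d where d: "dicycle (composition T K) d"
        "\<forall>u\<in>pverts T. path_covering_number (H u) \<le> card (pverts (K u) \<inter> cycle_verts d)"
      using hamiltonian_imp_covering_cycle[OF assms(1,5) K(1)] by blast
    then show "\<exists>C. cycle_subdigraph (composition T K) C \<and>
      (\<forall>u\<in>pverts T.
         path_covering_number (H u) \<le> card (pverts (K u) \<inter> (\<Union>c\<in>C. cycle_verts c)))"
      by (intro exI[of _ "{d}"]) (auto simp: cycle_subdigraph_def disjoint_family_on_def)
  next
    assume "\<exists>C. cycle_subdigraph (composition T K) C \<and>
      (\<forall>u\<in>pverts T.
         path_covering_number (H u) \<le> card (pverts (K u) \<inter> (\<Union>c\<in>C. cycle_verts c)))"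
    then show "\<exists>c. hamiltonian_cycle (composition T H) c"
      using covering_cycles_imp_hamiltonian[OF assms(1,5,2,3) K] by blast
  qed
qed

end
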